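(* Fix a finite set $S$ of first-order clauses and a depth limit $d$. If a closed connection tableau for $S$ exists within depth limit $d$, then the constraint-learning search procedure described in the context, run on $S$ with depth limit $d$, finds a closed tableau (i.e. it terminates with a closed tableau rather than by learning the empty constraint).
   Context: Clausal connection tableau calculus (free-variable, with a single global substitution $\sigma$, input a finite set $S$ of first-order clauses without equality). Inference rules: (Start) an empty tableau is extended by attaching the literals $L_1,\dots,L_n$ of a clause $C=L_1\vee\dots\vee L_n\in S$ (variables renamed apart from the tableau) as children of the root. (Reduction) an open branch whose leaf literal $L_1$ can be made complementary to a literal $L$ on its path (i.e. $\sigma(\lnot L)=\sigma(L_1)$ after extending $\sigma$ by a unifier) is closed, extending $\sigma$ accordingly. (Extension) below the leaf literal $L$ of an open branch, the literals $L_1,\dots,L_n$ of a renamed copy of a clause $C\in S$ are attached as children, where for the connected literal $L_i$ one requires $\sigma(\lnot L)=\sigma(L_i)$ after extending $\sigma$; the branch through $L_i$ is then closed. A tableau is closed when all branches are closed. Only tableaux whose branches do not exceed the depth limit are considered. Positions: the root is the empty position, and $p.i$ is the $i$-th child of position $p$; variables are named after the position below which their clause is attached, so names are stable under backtracking. Constraint language: an atom is one of $\mathcal{S}_C$ (the tableau was started with clause $C$), $\mathcal{R}^q_p$ (a reduction from position $p$ to an ancestor position $q$), or $\mathcal{E}^C_{p/i}$ (position $p$ was extended by connecting to the $i$-th literal of clause $C$). A constraint is a finite set of atoms. Each applied inference corresponds to an atom; a constraint is violated by a trail if all of its atoms are on the trail. Reasons. Let $T$ be a tableau built by a set of inferences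 $I$, $B$ an open branch, and $I'\subseteq I$ the inferences needed to produce $B$ (the start step and the extensions along the path to $B$), giving sub-tableau $T'$. If an inference $j$ applicable to $B$ in $T'$ is not applicable in $T$, a reason for its failure is a minimal $E\subseteq I\setminus I'$ such that applying $E$ additionally to $T'$ prevents applying $j$ at $B$. If no inference $j$ among those possible at $B$ in $T'$ can be applied in $T$, a reason that $T$ is stuck is $I'\cup\bigcup_j R_j$, where $R_j$ is a failure reason for $j$ as just defined if the calculus prevents $j$, and $R_j=R'\setminus\{j\}$ if $j$ is prevented because it would complete a previously learned constraint $R'$. Search procedure. Maintain the current tableau $T$ (with $\sigma$), a set of learned constraints (initially empty), and a trail (stack) of atoms of the inferences currently applied (initially empty). Repeat: select an open branch $B$ (for the empty tableau, choose a start clause); initialise a candidate constraint learn to $I'$ for $B$; for each possible inference $j$ at $B$: if $j$ cannot be applied in the calculus, add a failure reason for $j$ to learn; else if some learned constraint $C\cup\{j\}$ is violated by $j$ together with the trail, add $C$ to learn; otherwise apply $j$, push its atom onto the trail, and proceed to the next iteration. If no inference succeeded, pop atoms from the trail (undoing the corresponding inferences) until learn is no longer violated, and record learn as a learned constraint. Stop when $T$ is closed or when the learned constraint is empty. Learned constraints are never forgotten within one depth limit. *)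

theory Defs
  imports "HOL-Library.Sublist"
begin

section \<open>First-order clauses and unification\<close>

datatype ('f, 'v) tm = Var 'v | Fun 'f "('f, 'v) tm list"

datatype ('f, 'p, 'v) literal = Pos 'p "('f, 'v) tm list" | Neg 'p "('f, 'v) tm list"

text \<open>A clause is the list of its literals, because inferences refer to the i-th literal.
  Literal and child indices start at 0.\<close>

type_synonym ('f, 'p, 'v) clause = "('f, 'p, 'v) literal list"

primrec compl :: "('f, 'p, 'v) literal \<Rightarrow> ('f, 'p, 'v) literal" where
  "compl (Pos P ts) = Neg P ts"
| "compl (Neg P ts) = Pos P ts"

primrec subst_tm :: "('v \<Rightarrow> ('f, 'w) tm) \<Rightarrow> ('f, 'v) tm \<Rightarrow> ('f, 'w) tm" where
  "subst_tm \<sigma> (Var x) = \<sigma> x"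
| "subst_tm \<sigma> (Fun f ts) = Fun f (map (subst_tm \<sigma>) ts)"

primrec subst_lit :: "('v \<Rightarrow> ('f, 'w) tm) \<Rightarrow> ('f, 'p, 'v) literal \<Rightarrow> ('f, 'p, 'w) literal" where
  "subst_lit \<sigma> (Pos P ts) = Pos P (map (subst_tm \<sigma>) ts)"
| "subst_lit \<sigma> (Neg P ts) = Neg P (map (subst_tm \<sigma>) ts)"

text \<open>\<open>subst_comp \<mu> \<sigma>\<close> applies \<open>\<sigma>\<close> first.\<close>

definition subst_comp ::
  "('v \<Rightarrow> ('f, 'w) tm) \<Rightarrow> ('u \<Rightarrow> ('f, 'v) tm) \<Rightarrow> 'u \<Rightarrow> ('f, 'w) tm" where
  "subst_comp \<mu> \<sigma> = (\<lambda>x. subst_tm \<mu> (\<sigma> x))"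

definition is_mgu ::
  "('v \<Rightarrow> ('f, 'v) tm) \<Rightarrow> ('f, 'p, 'v) literal \<Rightarrow> ('f, 'p, 'v) literal \<Rightarrow> bool" where
  "is_mgu \<mu> K L \<longleftrightarrow> subst_lit \<mu> K = subst_lit \<mu> L \<and>
     (\<forall>\<tau> :: 'v \<Rightarrow> ('f, 'v) tm. subst_lit \<tau> K = subst_lit \<tau> L \<longrightarrow> (\<exists>\<gamma>. \<tau> = subst_comp \<gamma> \<mu>))"


section \<open>Connection tableaux\<close>

type_synonym pos = "nat list"

text \<open>The variable \<open>x\<close> of a clause attached below position \<open>p\<close> becomes \<open>(p, x)\<close>.\<close>

definition rename :: "pos \<Rightarrow> ('f, 'p, 'v) literal \<Rightarrow> ('f, 'p, pos \<times> 'v) literal" where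
  "rename p = subst_lit (\<lambda>x. Var (p, x))"

text \<open>The root is a node without a literal. \<open>expanded\<close> holds the positions below which a clause
  has been attached; without it the empty tableau could not be told apart from one started with
  the empty clause. A branch is identified with the position of its leaf.\<close>

record ('f, 'p, 'v) tableau =
  label :: "pos \<rightharpoonup> ('f, 'p, pos \<times> 'v) literal"
  expanded :: "pos set"
  closed_leaves :: "pos set"
  global_subst :: "pos \<times> 'v \<Rightarrow> ('f, pos \<times> 'v) tm"

definition empty_tableau :: "('f, 'p, 'v) tableau" where
  "empty_tableau = \<lparr>label = Map.empty, expanded = {}, closed_leaves = {}, global_subst = Var\<rparr>"

definition nodes :: "('f, 'p, 'v) tableau \<Rightarrow> pos set" where
  "nodes T = insert [] (dom (label T))"

definition open_branch :: "('f, 'p, 'v) tableau \<Rightarrow> pos \<Rightarrow> bool" where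
  "open_branch T p \<longleftrightarrow> p \<in> nodes T \<and> p \<notin> expanded T \<and> p \<notin> closed_leaves T"

definition is_closed :: "('f, 'p, 'v) tableau \<Rightarrow> bool" where
  "is_closed T \<longleftrightarrow> (\<nexists>p. open_branch T p)"

definition within_depth :: "nat \<Rightarrow> ('f, 'p, 'v) tableau \<Rightarrow> bool" where
  "within_depth d T \<longleftrightarrow> (\<forall>p \<in> nodes T. length p \<le> d)"

definition attach ::
  "pos \<Rightarrow> ('f, 'p, 'v) clause \<Rightarrow> ('f, 'p, 'v) tableau \<Rightarrow> ('f, 'p, 'v) tableau" where
  "attach p C T = T\<lparr>
     label := label T ++ map_of (map (\<lambda>i. (p @ [i], rename p (C ! i))) [0..<length C]),
     expanded := insert p (expanded T)\<rparr>"

definition close_leaf :: "pos \<Rightarrow> ('f, 'p, 'v) tableau \<Rightarrow> ('f, 'p, 'v) tableau" where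
  "close_leaf p T = T\<lparr>closed_leaves := insert p (closed_leaves T)\<rparr>"

definition extend_subst ::
  "(pos \<times> 'v \<Rightarrow> ('f, pos \<times> 'v) tm) \<Rightarrow> ('f, 'p, 'v) tableau \<Rightarrow> ('f, 'p, 'v) tableau" where
  "extend_subst \<mu> T = T\<lparr>global_subst := subst_comp \<mu> (global_subst T)\<rparr>"

text \<open>\<open>Start C\<close>, \<open>Reduction q p\<close> and \<open>Extension C p i\<close> stand for \<open>\<S>\<^sub>C\<close>, for the reduction from
  \<open>p\<close> to its ancestor \<open>q\<close>, and for the extension of \<open>p\<close> by connecting to the \<open>i\<close>-th literal
  of \<open>C\<close>.\<close>

datatype ('f, 'p, 'v) atom =
    Start "('f, 'p, 'v) clause"
  | Reduction pos pos
  | Extension "('f, 'p, 'v) clause" pos nat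

type_synonym ('f, 'p, 'v) constraint = "('f, 'p, 'v) atom set"

text \<open>The position of the open branch an inference acts on.\<close>

primrec acts_at :: "('f, 'p, 'v) atom \<Rightarrow> pos" where
  "acts_at (Start C) = []"
| "acts_at (Reduction q p) = p"
| "acts_at (Extension C p i) = p"

inductive infer ::
  "('f, 'p, 'v) clause set \<Rightarrow> nat \<Rightarrow> ('f, 'p, 'v) atom \<Rightarrow>
   ('f, 'p, 'v) tableau \<Rightarrow> ('f, 'p, 'v) tableau \<Rightarrow> bool"
  for S :: "('f, 'p, 'v) clause set" and d :: nat where
  start:
    "\<lbrakk>T = empty_tableau; C \<in> S; T' = attach [] C T; within_depth d T'\<rbrakk>
     \<Longrightarrow> infer S d (Start C) T T'"
| reduction:
    "\<lbrakk>open_branch T p; label T p = Some L1; strict_prefix q p; label T q = Some L;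
      is_mgu \<mu> (subst_lit (global_subst T) (compl L)) (subst_lit (global_subst T) L1);
      T' = extend_subst \<mu> (close_leaf p T); within_depth d T'\<rbrakk>
     \<Longrightarrow> infer S d (Reduction q p) T T'"
| extension:
    "\<lbrakk>open_branch T p; label T p = Some L; C \<in> S; i < length C;
      is_mgu \<mu> (subst_lit (global_subst T) (compl L))
               (subst_lit (global_subst T) (rename p (C ! i)));
      T' = extend_subst \<mu> (close_leaf (p @ [i]) (attach p C T)); within_depth d T'\<rbrakk>
     \<Longrightarrow> infer S d (Extension C p i) T T'"

definition applicable ::
  "('f, 'p, 'v) clause set \<Rightarrow> nat \<Rightarrow> ('f, 'p, 'v) atom \<Rightarrow> ('f, 'p, 'v) tableau \<Rightarrow> bool" where
  "applicable S d j T \<longleftrightarrow> (\<exists>T'. infer S d j T T')"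

primrec infers ::
  "('f, 'p, 'v) clause set \<Rightarrow> nat \<Rightarrow> ('f, 'p, 'v) atom list \<Rightarrow>
   ('f, 'p, 'v) tableau \<Rightarrow> ('f, 'p, 'v) tableau \<Rightarrow> bool" where
  "infers S d [] T T' \<longleftrightarrow> T' = T"
| "infers S d (j # js) T T' \<longleftrightarrow> (\<exists>U. infer S d j T U \<and> infers S d js U T')"

text \<open>\<open>T'\<close> results from applying all the inferences in \<open>E\<close> to \<open>T\<close>, in some order.\<close>

definition apply_all ::
  "('f, 'p, 'v) clause set \<Rightarrow> nat \<Rightarrow> ('f, 'p, 'v) atom set \<Rightarrow>
   ('f, 'p, 'v) tableau \<Rightarrow> ('f, 'p, 'v) tableau \<Rightarrow> bool" where
  "apply_all S d E T T' \<longleftrightarrow> (\<exists>js. distinct js \<and> set js = E \<and> infers S d js T T')"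

definition closed_tableau :: "('f, 'p, 'v) clause set \<Rightarrow> nat \<Rightarrow> ('f, 'p, 'v) tableau \<Rightarrow> bool" where
  "closed_tableau S d T \<longleftrightarrow> (\<exists>js. infers S d js empty_tableau T) \<and> is_closed T"


section \<open>Reasons\<close>

definition path_inferences :: "('f, 'p, 'v) atom set \<Rightarrow> pos \<Rightarrow> ('f, 'p, 'v) atom set" where
  "path_inferences I p =
     {j \<in> I. (\<exists>C. j = Start C \<and> p \<noteq> []) \<or> (\<exists>C q i. j = Extension C q i \<and> strict_prefix q p)}"

definition possible_inferences ::
  "('f, 'p, 'v) clause set \<Rightarrow> nat \<Rightarrow> ('f, 'p, 'v) atom set \<Rightarrow> pos \<Rightarrow> ('f, 'p, 'v) atom set" where
  "possible_inferences S d I p =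
     {j. acts_at j = p \<and>
         (\<exists>T'. apply_all S d (path_inferences I p) empty_tableau T' \<and> applicable S d j T')}"

definition prevents ::
  "('f, 'p, 'v) clause set \<Rightarrow> nat \<Rightarrow> ('f, 'p, 'v) atom set \<Rightarrow> pos \<Rightarrow>
   ('f, 'p, 'v) atom \<Rightarrow> ('f, 'p, 'v) atom set \<Rightarrow> bool" where
  "prevents S d I p j E \<longleftrightarrow>
     (\<exists>T' T''. apply_all S d (path_inferences I p) empty_tableau T' \<and>
               apply_all S d E T' T'' \<and> \<not> applicable S d j T'')"

definition failure_reason ::
  "('f, 'p, 'v) clause set \<Rightarrow> nat \<Rightarrow> ('f, 'p, 'v) atom set \<Rightarrow> pos \<Rightarrow>
   ('f, 'p, 'v) atom \<Rightarrow> ('f, 'p, 'v) atom set \<Rightarrow> bool" where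
  "failure_reason S d I p j E \<longleftrightarrow>
     E \<subseteq> I - path_inferences I p \<and> prevents S d I p j E \<and>
     (\<forall>E'. E' \<subset> E \<longrightarrow> \<not> prevents S d I p j E')"


section \<open>The search procedure\<close>

definition violated :: "('f, 'p, 'v) constraint \<Rightarrow> ('f, 'p, 'v) atom set \<Rightarrow> bool" where
  "violated c I \<longleftrightarrow> c \<subseteq> I"

text \<open>The stack has its top at the head of the list. Each atom is stored with the tableau to which
  its inference was applied, which is what undoing the inference restores.\<close>

type_synonym ('f, 'p, 'v) trail = "(('f, 'p, 'v) atom \<times> ('f, 'p, 'v) tableau) list"

definition trail_atoms :: "('f, 'p, 'v) trail \<Rightarrow> ('f, 'p, 'v) atom set" where
  "trail_atoms tr = fst ` set tr"

record ('f, 'p, 'v) state =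
  current :: "('f, 'p, 'v) tableau"
  trail :: "('f, 'p, 'v) trail"
  learned :: "('f, 'p, 'v) constraint set"

definition initial_state :: "('f, 'p, 'v) state" where
  "initial_state = \<lparr>current = empty_tableau, trail = [], learned = {}\<rparr>"

text \<open>A learned constraint violated by \<open>j\<close> together with the trail \<open>I\<close>.\<close>

definition blocks ::
  "('f, 'p, 'v) atom set \<Rightarrow> ('f, 'p, 'v) atom \<Rightarrow> ('f, 'p, 'v) constraint \<Rightarrow> bool" where
  "blocks I j c \<longleftrightarrow> j \<in> c \<and> violated c (insert j I)"

datatype ('f, 'p, 'v) outcome =
    Applied "('f, 'p, 'v) atom" "('f, 'p, 'v) tableau"
  | Stuck "('f, 'p, 'v) constraint"

text \<open>\<open>try_each S d s p js c r\<close>: the loop over the remaining possible inferences \<open>js\<close> at branch \<open>p\<close>,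
  entered with candidate constraint \<open>c\<close>, ends with outcome \<open>r\<close>.\<close>

inductive try_each ::
  "('f, 'p, 'v) clause set \<Rightarrow> nat \<Rightarrow> ('f, 'p, 'v) state \<Rightarrow> pos \<Rightarrow>
   ('f, 'p, 'v) atom list \<Rightarrow> ('f, 'p, 'v) constraint \<Rightarrow> ('f, 'p, 'v) outcome \<Rightarrow> bool"
  for S :: "('f, 'p, 'v) clause set" and d :: nat and s :: "('f, 'p, 'v) state" and p :: pos where
  exhausted:
    "try_each S d s p [] c (Stuck c)"
| fails:
    "\<lbrakk>\<not> applicable S d j (current s); failure_reason S d (trail_atoms (trail s)) p j E;
      try_each S d s p js (c \<union> E) r\<rbrakk>
     \<Longrightarrow> try_each S d s p (j # js) c r"
| blocked:
    "\<lbrakk>applicable S d j (current s); c' \<in> learned s; blocks (trail_atoms (trail s)) j c';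
      try_each S d s p js (c \<union> (c' - {j})) r\<rbrakk>
     \<Longrightarrow> try_each S d s p (j # js) c r"
| succeeds:
    "\<lbrakk>infer S d j (current s) T'; \<forall>c' \<in> learned s. \<not> blocks (trail_atoms (trail s)) j c'\<rbrakk>
     \<Longrightarrow> try_each S d s p (j # js) c (Applied j T')"

fun backtrack ::
  "('f, 'p, 'v) constraint \<Rightarrow> ('f, 'p, 'v) tableau \<Rightarrow> ('f, 'p, 'v) trail \<Rightarrow>
   ('f, 'p, 'v) tableau \<times> ('f, 'p, 'v) trail" where
  "backtrack c T [] = (T, [])"
| "backtrack c T ((j, T0) # tr) =
     (if violated c (trail_atoms ((j, T0) # tr)) then backtrack c T0 tr else (T, (j, T0) # tr))"

definition stopped :: "('f, 'p, 'v) state \<Rightarrow> bool" where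
  "stopped s \<longleftrightarrow> is_closed (current s) \<or> {} \<in> learned s"

text \<open>One iteration. The selected branch \<open>p\<close>, the order \<open>js\<close> in which the possible inferences are
  tried, the failure reasons and the blocking constraints are left open.\<close>

inductive iteration ::
  "('f, 'p, 'v) clause set \<Rightarrow> nat \<Rightarrow> ('f, 'p, 'v) state \<Rightarrow> ('f, 'p, 'v) state \<Rightarrow> bool"
  for S :: "('f, 'p, 'v) clause set" and d :: nat where
  apply_inference:
    "\<lbrakk>\<not> stopped s; open_branch (current s) p; I = trail_atoms (trail s);
      distinct js; set js = possible_inferences S d I p;
      try_each S d s p js (path_inferences I p) (Applied j T')\<rbrakk>
     \<Longrightarrow> iteration S d s (s\<lparr>current := T', trail := (j, current s) # trail s\<rparr>)"
| learn_constraint: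
    "\<lbrakk>\<not> stopped s; open_branch (current s) p; I = trail_atoms (trail s);
      distinct js; set js = possible_inferences S d I p;
      try_each S d s p js (path_inferences I p) (Stuck c);
      backtrack c (current s) (trail s) = (T', tr')\<rbrakk>
     \<Longrightarrow> iteration S d s \<lparr>current = T', trail = tr', learned = insert c (learned s)\<rparr>"

end

theory Submission
  imports Defs "HOL-Library.Disjoint_Sets"
begin

text \<open>
  The connections of a set of inferences are solvable independently of the order in which they are
  solved. Hence, for the atom set \<open>J\<close> of a closed tableau, every inference of \<open>J\<close> is applicable to
  every tableau built from a subset of \<open>J\<close> as soon as its branch exists there.
  No constraint \<open>c \<subseteq> J\<close> is ever learned: if \<open>c\<close> is learned at branch \<open>p\<close>, then \<open>J\<close> contains the
  path to \<open>p\<close> and therefore some inference \<open>j\<close> at \<open>p\<close>. Either \<open>c\<close> contains a failure reason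
  for \<open>j\<close>, which then consists of inferences of \<open>J\<close> that prevent \<open>j\<close>, or \<open>c\<close> contains
  \<open>c' - {j}\<close> for an earlier learned \<open>c'\<close>, and then already \<open>c' \<subseteq> J\<close>. In particular the empty
  constraint is not learned. The search terminates because within the depth limit there are finitely
  many atoms and every learned constraint is new.
\<close>

section \<open>Unification\<close>

lemma subst_tm_comp: "subst_tm \<mu> (subst_tm \<sigma> t) = subst_tm (subst_comp \<mu> \<sigma>) t"
  by (induction t) (auto simp: subst_comp_def)

lemma subst_lit_comp: "subst_lit \<mu> (subst_lit \<sigma> L) = subst_lit (subst_comp \<mu> \<sigma>) L"
  by (cases L) (auto simp: subst_tm_comp)

lemma subst_comp_assoc: "subst_comp \<gamma> (subst_comp \<mu> \<sigma>) = subst_comp (subst_comp \<gamma> \<mu>) \<sigma>"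
  by (rule ext) (simp add: subst_comp_def subst_tm_comp[unfolded subst_comp_def])

lemma subst_tm_Var: "subst_tm Var t = t"
  by (induction t) (auto simp: map_idI)

lemma subst_comp_Var_right: "subst_comp \<gamma> Var = \<gamma>"
  by (simp add: subst_comp_def)

lemma subst_comp_Var_left: "subst_comp Var \<sigma> = \<sigma>"
  by (simp add: subst_comp_def subst_tm_Var)

lemma subst_tm_cong: "(\<And>x. x \<in> set2_tm t \<Longrightarrow> \<sigma> x = \<tau> x) \<Longrightarrow> subst_tm \<sigma> t = subst_tm \<tau> t"
  by (induction t) auto

lemma set2_subst_tm: "set2_tm (subst_tm \<sigma> t) = (\<Union>x \<in> set2_tm t. set2_tm (\<sigma> x))"
  by (induction t) auto

lemma finite_set2_tm: "finite (set2_tm t)"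
  by (induction t) auto

lemma size_less_size_subst_tm:
  assumes "x \<in> set2_tm t" "t \<noteq> Var x"
  shows "size (\<tau> x) < size (subst_tm \<tau> t)"
  using assms
proof (induction t)
  case (Fun f ts)
  then obtain u where argument: "u \<in> set ts" "x \<in> set2_tm u" by auto
  then have "size (\<tau> x) \<le> size (subst_tm \<tau> u)"
    using Fun.IH[OF argument] by (cases "u = Var x") auto
  also have "\<dots> \<le> size_list size (map (subst_tm \<tau>) ts)"
    using argument(1) by (intro size_list_estimation') auto
  finally show ?case by simp
qed simp

definition most_general ::
  "('v \<Rightarrow> ('f, 'v) tm) \<Rightarrow> (('v \<Rightarrow> ('f, 'v) tm) \<Rightarrow> bool) \<Rightarrow> bool" where
  "most_general \<sigma> P \<longleftrightarrow> (\<forall>\<theta>. P \<theta> \<longleftrightarrow> (\<exists>\<gamma>. \<theta> = subst_comp \<gamma> \<sigma>))"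

lemma most_general_self:
  assumes "most_general \<sigma> P"
  shows "P \<sigma>"
proof -
  have "\<sigma> = subst_comp Var \<sigma>" by (simp add: subst_comp_Var_left)
  then show ?thesis using assms unfolding most_general_def by blast
qed

lemma most_general_Var: "most_general Var (\<lambda>_. True)"
  by (simp add: most_general_def subst_comp_Var_right)

lemma most_general_binding:
  fixes t :: "('f, 'v) tm"
  assumes "x \<notin> set2_tm t"
  shows "most_general (Var(x := t)) (\<lambda>\<tau>. \<tau> x = subst_tm \<tau> t)"
  unfolding most_general_def
proof (intro allI iffI)
  fix \<tau> :: "'v \<Rightarrow> ('f, 'v) tm"
  assume "\<tau> x = subst_tm \<tau> t"
  then have "\<tau> = subst_comp \<tau> (Var(x := t))" by (auto simp: subst_comp_def)
  then show "\<exists>\<gamma>. \<tau> = subst_comp \<gamma> (Var(x := t))" by blast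
next
  fix \<tau> :: "'v \<Rightarrow> ('f, 'v) tm"
  assume "\<exists>\<gamma>. \<tau> = subst_comp \<gamma> (Var(x := t))"
  then obtain \<gamma> where factor: "\<tau> = subst_comp \<gamma> (Var(x := t))" ..
  then have "subst_tm \<tau> t = subst_tm \<gamma> t"
    using assms by (intro subst_tm_cong) (auto simp: subst_comp_def)
  then show "\<tau> x = subst_tm \<tau> t" using factor by (simp add: subst_comp_def)
qed

lemma most_general_comp:
  assumes "most_general \<sigma> P" and "most_general \<mu> (\<lambda>\<gamma>. Q (subst_comp \<gamma> \<sigma>))"
  shows "most_general (subst_comp \<mu> \<sigma>) (\<lambda>\<theta>. P \<theta> \<and> Q \<theta>)"
proof -
  have first_iff: "P \<theta> \<longleftrightarrow> (\<exists>\<gamma>. \<theta> = subst_comp \<gamma> \<sigma>)" for \<theta>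
    using assms(1) by (simp add: most_general_def)
  have second_iff: "Q (subst_comp \<gamma> \<sigma>) \<longleftrightarrow> (\<exists>\<delta>. \<gamma> = subst_comp \<delta> \<mu>)" for \<gamma>
    using assms(2) by (simp add: most_general_def)
  show ?thesis
    unfolding most_general_def first_iff by (auto simp: second_iff subst_comp_assoc)
qed

lemma is_mgu_iff_most_general:
  fixes K L :: "('f, 'p, 'v) literal"
  shows "is_mgu \<mu> K L \<longleftrightarrow> most_general \<mu> (\<lambda>\<tau>. subst_lit \<tau> K = subst_lit \<tau> L)"
proof
  assume mgu: "is_mgu \<mu> K L"
  then have "subst_lit (subst_comp \<gamma> \<mu>) K = subst_lit (subst_comp \<gamma> \<mu>) L"
    for \<gamma> :: "'v \<Rightarrow> ('f, 'v) tm"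
    by (simp add: is_mgu_def flip: subst_lit_comp)
  with mgu show "most_general \<mu> (\<lambda>\<tau>. subst_lit \<tau> K = subst_lit \<tau> L)"
    unfolding is_mgu_def most_general_def by blast
next
  assume "most_general \<mu> (\<lambda>\<tau>. subst_lit \<tau> K = subst_lit \<tau> L)"
  then show "is_mgu \<mu> K L"
    using most_general_self[of \<mu> "\<lambda>\<tau>. subst_lit \<tau> K = subst_lit \<tau> L"]
    by (simp add: is_mgu_def most_general_def)
qed

type_synonym ('f, 'v) equations = "(('f, 'v) tm \<times> ('f, 'v) tm) list"

definition unifies :: "('v \<Rightarrow> ('f, 'w) tm) \<Rightarrow> ('f, 'v) equations \<Rightarrow> bool" where
  "unifies \<tau> es \<longleftrightarrow> (\<forall>(s, t) \<in> set es. subst_tm \<tau> s = subst_tm \<tau> t)"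

definition eqs_vars :: "('f, 'v) equations \<Rightarrow> 'v set" where
  "eqs_vars es = (\<Union>(s, t) \<in> set es. set2_tm s \<union> set2_tm t)"

definition subst_eqs ::
  "('v \<Rightarrow> ('f, 'w) tm) \<Rightarrow> ('f, 'v) equations \<Rightarrow> ('f, 'w) equations" where
  "subst_eqs \<sigma> = map (\<lambda>(s, t). (subst_tm \<sigma> s, subst_tm \<sigma> t))"

lemma unifies_Nil: "unifies \<tau> []"
  by (simp add: unifies_def)

lemma unifies_Cons: "unifies \<tau> ((s, t) # es) \<longleftrightarrow> subst_tm \<tau> s = subst_tm \<tau> t \<and> unifies \<tau> es"
  by (auto simp: unifies_def)

lemma unifies_append: "unifies \<tau> (es @ es') \<longleftrightarrow> unifies \<tau> es \<and> unifies \<tau> es'"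
  by (auto simp: unifies_def)

lemma unifies_zip:
  assumes "length ss = length ts"
  shows "unifies \<tau> (zip ss ts) \<longleftrightarrow> map (subst_tm \<tau>) ss = map (subst_tm \<tau>) ts"
  using assms by (auto simp: unifies_def list_eq_iff_nth_eq in_set_zip)

lemma unifies_subst_eqs: "unifies \<tau> (subst_eqs \<sigma> es) \<longleftrightarrow> unifies (subst_comp \<tau> \<sigma>) es"
  by (force simp: unifies_def subst_eqs_def subst_tm_comp)

lemma finite_eqs_vars: "finite (eqs_vars es)"
  by (auto simp: eqs_vars_def finite_set2_tm)

lemma eqs_vars_Cons: "eqs_vars ((s, t) # es) = set2_tm s \<union> set2_tm t \<union> eqs_vars es"
  by (auto simp: eqs_vars_def)

lemma eqs_vars_subst_binding:
  assumes "x \<notin> set2_tm t"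
  shows "eqs_vars (subst_eqs (Var(x := t)) es) \<subseteq> eqs_vars ((Var x, t) # es) - {x}"
proof -
  have "set2_tm (subst_tm (Var(x := t)) s) \<subseteq> set2_tm s \<union> set2_tm t - {x}" for s
    using assms by (auto simp: set2_subst_tm split: if_splits)
  then show ?thesis by (fastforce simp: eqs_vars_def subst_eqs_def)
qed

lemma eqs_vars_zip:
  "eqs_vars (zip ss ts @ es) \<subseteq> eqs_vars ((Fun f ss, Fun g ts) # es)"
  by (fastforce simp: eqs_vars_def dest: set_zip_leftD set_zip_rightD)

text \<open>The last measure is needed for swaps: a constant has the same size as a variable.\<close>

definition unify_order :: "(('f, 'v) equations \<times> ('f, 'v) equations) set" where
  "unify_order = measures
     [\<lambda>es. card (eqs_vars es), \<lambda>es. sum_list (map (size \<circ> fst) es), length,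
      \<lambda>es. length (filter (\<lambda>(s, t). \<exists>f ss. s = Fun f ss) es)]"

lemma unify_order_trivial: "(es, (Var x, t) # es) \<in> unify_order"
proof -
  have "card (eqs_vars es) \<le> card (eqs_vars ((Var x, t) # es))"
    by (intro card_mono finite_eqs_vars) (auto simp: eqs_vars_Cons)
  then show ?thesis by (auto simp: unify_order_def le_less)
qed

lemma unify_order_binding:
  assumes "x \<notin> set2_tm t"
  shows "(subst_eqs (Var(x := t)) es, (Var x, t) # es) \<in> unify_order"
proof -
  have "eqs_vars (subst_eqs (Var(x := t)) es) \<subset> eqs_vars ((Var x, t) # es)"
    using eqs_vars_subst_binding[OF assms, of es] by (auto simp: eqs_vars_Cons)
  then show ?thesis
    unfolding unify_order_def by (intro measures_less psubset_card_mono finite_eqs_vars)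
qed

lemma unify_order_swap: "((Var x, Fun f ss) # es, (Fun f ss, Var x) # es) \<in> unify_order"
  by (auto simp: unify_order_def eqs_vars_Cons Un_commute)

lemma unify_order_zip:
  assumes "length ss = length ts"
  shows "(zip ss ts @ es, (Fun f ss, Fun g ts) # es) \<in> unify_order"
proof -
  have "card (eqs_vars (zip ss ts @ es)) \<le> card (eqs_vars ((Fun f ss, Fun g ts) # es))"
    by (intro card_mono finite_eqs_vars eqs_vars_zip)
  moreover have "sum_list (map (size \<circ> fst) (zip ss ts @ es)) <
      sum_list (map (size \<circ> fst) ((Fun f ss, Fun g ts) # es))"
    using assms by (simp add: size_list_conv_sum_list map_map[symmetric] del: map_map)
  ultimately show ?thesis
    unfolding unify_order_def by (intro measures_lesseq measures_less)
qed

function unify :: "('f, 'v) equations \<Rightarrow> ('v \<Rightarrow> ('f, 'v) tm) option" where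
  "unify [] = Some Var"
| "unify ((Var x, t) # es) =
     (if t = Var x then unify es
      else if x \<in> set2_tm t then None
      else map_option (\<lambda>\<mu>. subst_comp \<mu> (Var(x := t))) (unify (subst_eqs (Var(x := t)) es)))"
| "unify ((Fun f ss, Var x) # es) = unify ((Var x, Fun f ss) # es)"
| "unify ((Fun f ss, Fun g ts) # es) =
     (if f = g \<and> length ss = length ts then unify (zip ss ts @ es) else None)"
  by pat_completeness auto

termination
proof (relation unify_order)
  show "wf unify_order" by (simp add: unify_order_def)
qed (simp_all add: unify_order_trivial unify_order_binding unify_order_swap unify_order_zip)

lemma unify_most_general:
  fixes \<tau> :: "'v \<Rightarrow> ('f, 'v) tm"
  assumes "unifies \<tau> es"
  shows "\<exists>\<mu>. unify es = Some \<mu> \<and> most_general \<mu> (\<lambda>\<theta>. unifies \<theta> es)"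
  using assms
proof (induction es rule: unify.induct[case_names Nil Eliminate Swap Decompose])
  case Nil
  show ?case by (simp add: unifies_Nil most_general_Var)
next
  case (Eliminate x t es)
  have binding: "\<tau> x = subst_tm \<tau> t" and rest: "unifies \<tau> es"
    using Eliminate.prems by (simp_all add: unifies_Cons)
  show ?case
  proof (cases "t = Var x")
    case True
    then show ?thesis using Eliminate.IH(1) rest by (simp add: unifies_Cons)
  next
    case False
    then have not_occurs: "x \<notin> set2_tm t"
      using binding size_less_size_subst_tm by (metis less_irrefl)
    have "subst_comp \<tau> (Var(x := t)) = \<tau>" using binding by (auto simp: subst_comp_def)
    then obtain \<mu> where eliminated: "unify (subst_eqs (Var(x := t)) es) = Some \<mu>"
        "most_general \<mu> (\<lambda>\<gamma>. unifies (subst_comp \<gamma> (Var(x := t))) es)"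
      using Eliminate.IH(2)[OF False not_occurs] rest by (auto simp: unifies_subst_eqs)
    then show ?thesis
      using most_general_comp[OF most_general_binding[OF not_occurs] eliminated(2)]
        eliminated(1) False not_occurs
      by (simp add: unifies_Cons del: fun_upd_apply)
  qed
next
  case (Swap f ss x es)
  then show ?case by (simp add: unifies_Cons eq_commute)
next
  case (Decompose f ss g ts es)
  then have "map (subst_tm \<tau>) ss = map (subst_tm \<tau>) ts" and head: "f = g"
    by (simp_all add: unifies_Cons)
  then have arity: "length ss = length ts" by (metis length_map)
  with head have "unifies \<theta> ((Fun f ss, Fun g ts) # es) \<longleftrightarrow> unifies \<theta> (zip ss ts @ es)"
    for \<theta> :: "'v \<Rightarrow> ('f, 'v) tm"
    by (simp add: unifies_Cons unifies_append unifies_zip)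
  moreover obtain \<mu> where "unify (zip ss ts @ es) = Some \<mu>"
      "most_general \<mu> (\<lambda>\<theta>. unifies \<theta> (zip ss ts @ es))"
    using Decompose head arity calculation by blast
  ultimately show ?case using head arity by simp
qed

lemma is_mgu_exists:
  fixes \<tau> :: "'v \<Rightarrow> ('f, 'v) tm"
  assumes "subst_lit \<tau> K = subst_lit \<tau> L"
  shows "\<exists>\<mu>. is_mgu \<mu> K L"
proof -
  obtain ss ts where args: "\<And>\<theta> :: 'v \<Rightarrow> ('f, 'v) tm.
      subst_lit \<theta> K = subst_lit \<theta> L \<longleftrightarrow> map (subst_tm \<theta>) ss = map (subst_tm \<theta>) ts"
    using assms by (cases K; cases L) auto
  then have "length ss = length ts" using assms by (metis length_map)
  then have "subst_lit \<theta> K = subst_lit \<theta> L \<longleftrightarrow> unifies \<theta> (zip ss ts)"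
    for \<theta> :: "'v \<Rightarrow> ('f, 'v) tm"
    by (simp add: args unifies_zip)
  then show ?thesis
    using unify_most_general[of \<tau> "zip ss ts"] assms by (auto simp: is_mgu_iff_most_general)
qed

section \<open>Sets of inferences\<close>

inductive attached :: "('f, 'p, 'v) atom set \<Rightarrow> pos \<Rightarrow> ('f, 'p, 'v) clause \<Rightarrow> bool"
  for I :: "('f, 'p, 'v) atom set" where
  attached_Start: "Start C \<in> I \<Longrightarrow> attached I [] C"
| attached_Extension: "Extension C p i \<in> I \<Longrightarrow> attached I p C"

inductive lit_at :: "('f, 'p, 'v) atom set \<Rightarrow> pos \<Rightarrow> ('f, 'p, pos \<times> 'v) literal \<Rightarrow> bool"
  for I :: "('f, 'p, 'v) atom set" where
  lit_atI: "attached I p C \<Longrightarrow> i < length C \<Longrightarrow> lit_at I (p @ [i]) (rename p (C ! i))"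

definition nodes_of :: "('f, 'p, 'v) atom set \<Rightarrow> pos set" where
  "nodes_of I = insert [] {p. \<exists>L. lit_at I p L}"

primrec occupies :: "('f, 'p, 'v) atom \<Rightarrow> pos set" where
  "occupies (Start C) = {[]}"
| "occupies (Reduction q p) = {p}"
| "occupies (Extension C p i) = {p, p @ [i]}"

definition occupied :: "('f, 'p, 'v) atom set \<Rightarrow> pos set" where
  "occupied I = (\<Union>j \<in> I. occupies j)"

primrec legal :: "('f, 'p, 'v) clause set \<Rightarrow> nat \<Rightarrow> ('f, 'p, 'v) atom \<Rightarrow> bool" where
  "legal S d (Start C) \<longleftrightarrow> C \<in> S \<and> (C = [] \<or> 0 < d)"
| "legal S d (Reduction q p) \<longleftrightarrow> q \<noteq> [] \<and> strict_prefix q p"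
| "legal S d (Extension C p i) \<longleftrightarrow> C \<in> S \<and> i < length C \<and> p \<noteq> [] \<and> length p < d"

primrec satisfies ::
  "(pos \<times> 'v \<Rightarrow> ('f, pos \<times> 'v) tm) \<Rightarrow> ('f, 'p, 'v) atom set \<Rightarrow> ('f, 'p, 'v) atom \<Rightarrow> bool" where
  "satisfies \<theta> I (Start C) \<longleftrightarrow> True"
| "satisfies \<theta> I (Reduction q p) \<longleftrightarrow>
     (\<forall>L L1. lit_at I q L \<longrightarrow> lit_at I p L1 \<longrightarrow> subst_lit \<theta> (compl L) = subst_lit \<theta> L1)"
| "satisfies \<theta> I (Extension C p i) \<longleftrightarrow>
     (\<forall>L. lit_at I p L \<longrightarrow> subst_lit \<theta> (compl L) = subst_lit \<theta> (rename p (C ! i)))"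

definition solves ::
  "(pos \<times> 'v \<Rightarrow> ('f, pos \<times> 'v) tm) \<Rightarrow> ('f, 'p, 'v) atom set \<Rightarrow> bool" where
  "solves \<theta> I \<longleftrightarrow> (\<forall>j \<in> I. satisfies \<theta> I j)"

lemma attached_acts_at:
  assumes "attached I p C"
  obtains j where "j \<in> I" "acts_at j = p"
  using assms by (cases rule: attached.cases) force+

lemma attached_mono: "I \<subseteq> J \<Longrightarrow> attached I p C \<Longrightarrow> attached J p C"
  by (auto elim!: attached.cases intro: attached.intros)

lemma attached_insert:
  "attached (insert (Start C) I) p D \<longleftrightarrow> p = [] \<and> D = C \<or> attached I p D"
  "attached (insert (Reduction q r) I) p D \<longleftrightarrow> attached I p D"
  "attached (insert (Extension C r i) I) p D \<longleftrightarrow> p = r \<and> D = C \<or> attached I p D"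
  by (auto simp: attached.simps)

lemma lit_at_Nil: "\<not> lit_at I [] L"
  by (simp add: lit_at.simps)

lemma lit_at_append:
  "lit_at I (p @ [i]) L \<longleftrightarrow> (\<exists>C. attached I p C \<and> i < length C \<and> L = rename p (C ! i))"
  by (auto simp: lit_at.simps)

lemma lit_at_mono: "I \<subseteq> J \<Longrightarrow> lit_at I p L \<Longrightarrow> lit_at J p L"
  by (auto simp: lit_at.simps dest: attached_mono)

lemma nodes_of_Nil: "[] \<in> nodes_of I"
  by (simp add: nodes_of_def)

lemma nodes_of_append: "p @ [i] \<in> nodes_of I \<longleftrightarrow> (\<exists>C. attached I p C \<and> i < length C)"
  unfolding nodes_of_def using lit_at_append[of I p i] by auto

lemma nodes_of_lit_at:
  assumes "p \<in> nodes_of I" "p \<noteq> []"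
  obtains L where "lit_at I p L"
  using assms by (auto simp: nodes_of_def)

lemma nodes_of_mono: "I \<subseteq> J \<Longrightarrow> nodes_of I \<subseteq> nodes_of J"
  by (auto simp: nodes_of_def dest: lit_at_mono)

lemma occupied_insert: "occupied (insert j I) = occupies j \<union> occupied I"
  by (simp add: occupied_def)

lemma acts_at_occupies: "acts_at j \<in> occupies j"
  by (cases j) auto

lemma acts_at_occupied: "j \<in> I \<Longrightarrow> acts_at j \<in> occupied I"
  using acts_at_occupies by (auto simp: occupied_def)

lemma attached_occupied: "attached I p C \<Longrightarrow> p \<in> occupied I"
  by (metis attached_acts_at acts_at_occupied)

lemma satisfies_antimono: "I \<subseteq> J \<Longrightarrow> satisfies \<theta> J j \<Longrightarrow> satisfies \<theta> I j"
  by (cases j) (auto dest: lit_at_mono)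

lemma solves_antimono: "I \<subseteq> J \<Longrightarrow> solves \<theta> J \<Longrightarrow> solves \<theta> I"
  unfolding solves_def using satisfies_antimono by blast

locale well_formed =
  fixes S :: "('f, 'p, 'v) clause set" and d :: nat and I :: "('f, 'p, 'v) atom set"
  assumes finite_inferences: "finite I"
    and occupies_disjoint: "disjoint_family_on occupies I"
    and legal: "j \<in> I \<Longrightarrow> legal S d j"
    and acts_at_node: "j \<in> I \<Longrightarrow> acts_at j \<in> nodes_of I"

lemma well_formed_empty: "well_formed S d {}"
  by unfold_locales (simp_all add: disjoint_family_on_def)

lemma well_formed_subset:
  assumes "well_formed S d J" "I \<subseteq> J" "\<And>j. j \<in> I \<Longrightarrow> acts_at j \<in> nodes_of I"
  shows "well_formed S d I"
proof -
  interpret J: well_formed S d J by fact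
  show ?thesis
    using assms(2,3) J.finite_inferences J.occupies_disjoint J.legal
    by unfold_locales (auto intro: finite_subset disjoint_family_on_mono)
qed

context well_formed
begin

lemma occupied_unique:
  assumes "j \<in> I" "k \<in> I" "p \<in> occupies j" "p \<in> occupies k"
  shows "j = k"
  using disjoint_family_onD[OF occupies_disjoint] assms by blast

lemma acts_at_unique:
  assumes "j \<in> I" "k \<in> I" "acts_at j = acts_at k"
  shows "j = k"
  using assms acts_at_occupies by (metis occupied_unique)

lemma attached_unique:
  assumes "attached I p C" "attached I p D"
  shows "C = D"
  using assms by (auto elim!: attached.cases dest: acts_at_unique)

lemma lit_at_unique:
  assumes "lit_at I p L" "lit_at I p L'"
  shows "L = L'"
  using assms by (cases p rule: rev_cases)
    (auto simp: lit_at_Nil lit_at_append dest: attached_unique)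

lemma attached_legal:
  assumes "attached I p C"
  shows "C \<in> S" and "C = [] \<or> length p < d" and "p \<in> nodes_of I"
  using assms legal acts_at_node by (force elim!: attached.cases)+

lemma length_node_le: "p \<in> nodes_of I \<Longrightarrow> length p \<le> d"
  by (cases p rule: rev_cases) (auto simp: nodes_of_append dest: attached_legal(2))

lemma prefix_node:
  assumes "p \<in> nodes_of I" "prefix q p"
  shows "q \<in> nodes_of I"
  using assms
proof (induction p rule: rev_induct)
  case (snoc i p)
  moreover have "p \<in> nodes_of I"
    using snoc.prems(1) attached_legal(3) by (auto simp: nodes_of_append)
  ultimately show ?case by auto
qed simp

lemma lit_at_subset:
  assumes "I' \<subseteq> I" "p \<in> nodes_of I'"
  shows "lit_at I p L \<longleftrightarrow> lit_at I' p L"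
proof (cases "p = []")
  case False
  then show ?thesis
    using assms nodes_of_lit_at lit_at_mono lit_at_unique by metis
qed (simp add: lit_at_Nil)

lemma root_occupied:
  assumes "I \<noteq> {}"
  shows "[] \<in> occupied I"
proof -
  obtain j where "j \<in> I" using assms by blast
  then have node: "acts_at j \<in> nodes_of I" by (rule acts_at_node)
  show ?thesis
  proof (cases "acts_at j")
    case Nil
    then show ?thesis using acts_at_occupied[OF \<open>j \<in> I\<close>] by simp
  next
    case (Cons i p)
    then have "[] @ [i] \<in> nodes_of I" by (intro prefix_node[OF node]) auto
    then show ?thesis unfolding nodes_of_append by (blast intro: attached_occupied)
  qed
qed

lemma well_formed_insert:
  assumes "acts_at j \<in> nodes_of I - occupied I" and "legal S d j"
  shows "well_formed S d (insert j I)"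
proof
  have "p @ [i] \<notin> occupied I" if "p \<notin> occupied I" for p i
  proof
    assume "p @ [i] \<in> occupied I"
    then obtain k where occupant: "k \<in> I" "p @ [i] \<in> occupies k" by (auto simp: occupied_def)
    then have "acts_at k = p @ [i] \<or> acts_at k = p" by (cases k) auto
    then show False
    proof
      assume "acts_at k = p @ [i]"
      then show False
        using that acts_at_node[OF occupant(1)] attached_occupied by (auto simp: nodes_of_append)
    next
      assume "acts_at k = p"
      then show False using that acts_at_occupied[OF occupant(1)] by simp
    qed
  qed
  then have "occupies j \<inter> occupied I = {}" using assms(1) by (cases j) auto
  then show "disjoint_family_on occupies (insert j I)"
    using occupies_disjoint assms(1) acts_at_occupied
    by (subst disjoint_family_on_insert) (auto simp: occupied_def)
  show "acts_at k \<in> nodes_of (insert j I)" if "k \<in> insert j I" for k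
    using that assms(1) acts_at_node nodes_of_mono[OF subset_insertI] by blast
qed (use assms(2) finite_inferences legal in auto)

end

lemma satisfies_superset:
  assumes "well_formed S d I" "well_formed S d J" "I \<subseteq> J"
    and "legal S d j" "acts_at j \<in> nodes_of I"
  shows "satisfies \<theta> J j \<longleftrightarrow> satisfies \<theta> I j"
proof -
  interpret I: well_formed S d I by fact
  interpret J: well_formed S d J by fact
  have same_literal: "lit_at J q L \<longleftrightarrow> lit_at I q L" if "prefix q (acts_at j)" for q L
    using assms(3) I.prefix_node[OF assms(5) that] by (rule J.lit_at_subset)
  show ?thesis
    using assms(4) by (cases j) (auto simp: same_literal)
qed

lemma solves_insert:
  assumes "well_formed S d I" and "acts_at j \<in> nodes_of I - occupied I" "legal S d j"
  shows "solves \<theta> (insert j I) \<longleftrightarrow> solves \<theta> I \<and> satisfies \<theta> I j"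
proof -
  interpret well_formed S d I by fact
  have "satisfies \<theta> (insert j I) k \<longleftrightarrow> satisfies \<theta> I k" if "k \<in> insert j I" for k
    using that assms(2,3) legal acts_at_node
    by (intro satisfies_superset[OF assms(1) well_formed_insert[OF assms(2,3)]]) auto
  then show ?thesis by (auto simp: solves_def)
qed

section \<open>Derivable tableaux\<close>

text \<open>The set of inferences determines, whatever their order, the labels and the open branches of a
  tableau, and up to renaming its substitution, a most general simultaneous unifier of all
  connections.\<close>

locale represents = well_formed S d I
  for S :: "('f, 'p, 'v) clause set" and d :: nat and I :: "('f, 'p, 'v) atom set" +
  fixes T :: "('f, 'p, 'v) tableau"
  assumes empty: "I = {} \<Longrightarrow> T = empty_tableau"
    and label: "label T p = Some L \<longleftrightarrow> lit_at I p L"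
    and occupied: "expanded T \<union> closed_leaves T = occupied I"
    and most_general: "most_general (global_subst T) (\<lambda>\<theta>. solves \<theta> I)"

primrec perform ::
  "('f, 'p, 'v) atom \<Rightarrow> ('f, 'p, 'v) tableau \<Rightarrow> ('f, 'p, 'v) tableau" where
  "perform (Start C) T = attach [] C T"
| "perform (Reduction q p) T = close_leaf p T"
| "perform (Extension C p i) T = close_leaf (p @ [i]) (attach p C T)"

lemma label_attach:
  "label (attach p C T) q = Some L \<longleftrightarrow>
     (\<exists>i < length C. q = p @ [i] \<and> L = rename p (C ! i)) \<or>
     label T q = Some L \<and> (\<forall>i < length C. q \<noteq> p @ [i])"
proof -
  let ?children = "map_of (map (\<lambda>i. (p @ [i], rename p (C ! i))) [0..<length C])"
  have label_eq: "label (attach p C T) = label T ++ ?children" by (simp add: attach_def)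
  show ?thesis
  proof (cases "\<exists>i < length C. q = p @ [i]")
    case True
    then obtain i where child: "i < length C" "q = p @ [i]" by blast
    then have "?children q = Some (rename p (C ! i))"
      by (intro map_of_is_SomeI) (auto simp: distinct_map inj_on_def comp_def)
    then show ?thesis using child by (auto simp: label_eq)
  next
    case False
    then have "?children q = None" by (auto simp: map_of_eq_None_iff)
    then show ?thesis using False by (auto simp: label_eq map_add_def)
  qed
qed

lemma within_depth_attach:
  "within_depth d (attach p C T) \<longleftrightarrow> within_depth d T \<and> (C = [] \<or> length p < d)"
proof -
  have "dom (label (attach p C T)) = dom (label T) \<union> (\<lambda>i. p @ [i]) ` {..<length C}"
    by (auto simp: dom_def label_attach)
  then have "nodes (attach p C T) = nodes T \<union> (\<lambda>i. p @ [i]) ` {..<length C}"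
    by (auto simp: nodes_def)
  then have "within_depth d (attach p C T) \<longleftrightarrow>
      within_depth d T \<and> (\<forall>i < length C. length (p @ [i]) \<le> d)"
    unfolding within_depth_def by blast
  then show ?thesis by auto
qed

lemma within_depth_close_leaf: "within_depth d (close_leaf p T) \<longleftrightarrow> within_depth d T"
  by (simp add: within_depth_def nodes_def close_leaf_def)

lemma within_depth_extend_subst: "within_depth d (extend_subst \<mu> T) \<longleftrightarrow> within_depth d T"
  by (simp add: within_depth_def nodes_def extend_subst_def)

lemma extend_subst_Var: "extend_subst Var T = T"
  by (simp add: extend_subst_def subst_comp_Var_left)

lemma occupied_perform:
  "expanded (perform j T) \<union> closed_leaves (perform j T) =
     occupies j \<union> (expanded T \<union> closed_leaves T)"
  by (cases j) (auto simp: attach_def close_leaf_def)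

lemma global_subst_perform: "global_subst (perform j T) = global_subst T"
  by (cases j) (simp_all add: attach_def close_leaf_def)

lemma within_depth_perform:
  assumes "within_depth d T" "legal S d j"
  shows "within_depth d (extend_subst \<mu> (perform j T))"
  using assms
  by (cases j) (auto simp: within_depth_attach within_depth_close_leaf within_depth_extend_subst)

lemma represents_empty: "represents S d {} empty_tableau"
proof -
  interpret well_formed S d "{}" by (rule well_formed_empty)
  show ?thesis
    by unfold_locales
      (auto simp: empty_tableau_def lit_at.simps attached.simps occupied_def solves_def
        most_general_Var)
qed

context represents
begin

lemma nodes_eq: "nodes T = nodes_of I"
  by (auto simp: nodes_def nodes_of_def dom_def label)

lemma within_depth: "within_depth d T"
  by (simp add: within_depth_def nodes_eq length_node_le)

lemma open_branch_iff: "open_branch T p \<longleftrightarrow> p \<in> nodes_of I - occupied I"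
  using occupied by (auto simp: open_branch_def nodes_eq)

lemma solves_global_subst: "solves (global_subst T) I"
  using most_general by (rule most_general_self)

lemma satisfies_label:
  shows "label T q = Some L \<Longrightarrow> label T p = Some L1 \<Longrightarrow>
      satisfies \<theta> I (Reduction q p) \<longleftrightarrow> subst_lit \<theta> (compl L) = subst_lit \<theta> L1"
    and "label T p = Some L \<Longrightarrow>
      satisfies \<theta> I (Extension C p i) \<longleftrightarrow> subst_lit \<theta> (compl L) = subst_lit \<theta> (rename p (C ! i))"
  by (auto simp: label dest: lit_at_unique)

lemma is_mgu_label:
  "is_mgu \<mu> (subst_lit (global_subst T) K) (subst_lit (global_subst T) L) \<longleftrightarrow>
     most_general \<mu> (\<lambda>\<gamma>. subst_lit (subst_comp \<gamma> (global_subst T)) K =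
       subst_lit (subst_comp \<gamma> (global_subst T)) L)"
  by (simp add: is_mgu_iff_most_general subst_lit_comp)

lemma infer_perform:
  assumes "infer S d j T T'"
  shows "legal S d j \<and> open_branch T (acts_at j) \<and>
    (\<exists>\<mu>. most_general \<mu> (\<lambda>\<gamma>. satisfies (subst_comp \<gamma> (global_subst T)) I j) \<and>
      T' = extend_subst \<mu> (perform j T))"
  using assms
proof cases
  case (start C)
  then have "legal S d j" by (simp add: within_depth_attach)
  moreover have "open_branch T []"
    using start by (simp add: open_branch_def nodes_def empty_tableau_def)
  moreover have "T' = extend_subst Var (perform j T)"
    using start by (simp add: extend_subst_Var)
  ultimately show ?thesis using start most_general_Var by auto
next
  case (reduction p L1 q L \<mu>)
  have "q \<noteq> []" using reduction by (auto simp: label lit_at_Nil)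
  then show ?thesis
    using reduction by (auto simp: is_mgu_label satisfies_label simp del: satisfies.simps)
next
  case (extension p L C i \<mu>)
  have "p \<noteq> []" using extension by (auto simp: label lit_at_Nil)
  moreover have "length p < d"
    using extension
    by (auto simp: within_depth_attach within_depth_close_leaf within_depth_extend_subst)
  ultimately show ?thesis
    using extension by (auto simp: is_mgu_label satisfies_label simp del: satisfies.simps)
qed

lemma unifiable_connection:
  assumes "solves \<theta> I" "subst_lit \<theta> K = subst_lit \<theta> L"
  obtains \<mu> where "is_mgu \<mu> (subst_lit (global_subst T) K) (subst_lit (global_subst T) L)"
proof -
  obtain \<gamma> where "\<theta> = subst_comp \<gamma> (global_subst T)"
    using assms(1) most_general by (auto simp: most_general_def)
  then show ?thesis using assms(2) that is_mgu_exists by (metis subst_lit_comp)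
qed

lemma applicableI:
  assumes node: "acts_at j \<in> nodes_of I - occupied I" and legal_atom: "legal S d j"
    and solution: "solves \<theta> I" "satisfies \<theta> I j"
  shows "applicable S d j T"
proof (cases j)
  case (Start C)
  then have "T = empty_tableau"
    using node root_occupied empty by auto
  moreover have "within_depth d (attach [] C T)"
    using within_depth_perform[OF within_depth legal_atom, of Var] Start
    by (simp add: extend_subst_Var)
  ultimately show ?thesis
    using Start legal_atom by (auto simp: applicable_def intro: infer.start)
next
  case (Reduction q p)
  then have "p \<in> nodes_of I" "q \<in> nodes_of I" "p \<noteq> []" "q \<noteq> []" "strict_prefix q p"
    using node legal_atom prefix_node[of p q] by (auto simp: strict_prefix_def)
  then obtain L L1 where labels: "label T q = Some L" "label T p = Some L1"
    by (metis label nodes_of_lit_at)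
  then obtain \<mu> where "is_mgu \<mu> (subst_lit (global_subst T) (compl L))
      (subst_lit (global_subst T) L1)"
    using unifiable_connection[OF solution(1)] solution(2) satisfies_label(1) Reduction by metis
  then show ?thesis
    using Reduction node labels \<open>strict_prefix q p\<close>
      within_depth_perform[OF within_depth legal_atom, of \<mu>]
    by (auto simp: applicable_def open_branch_iff intro!: exI infer.reduction)
next
  case (Extension C p i)
  then have "p \<in> nodes_of I" "p \<noteq> []" using node legal_atom by auto
  then obtain L where labels: "label T p = Some L" by (metis label nodes_of_lit_at)
  then obtain \<mu> where "is_mgu \<mu> (subst_lit (global_subst T) (compl L))
      (subst_lit (global_subst T) (rename p (C ! i)))"
    using unifiable_connection[OF solution(1)] solution(2) satisfies_label(2) Extension by metis
  then show ?thesis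
    using Extension node legal_atom labels within_depth_perform[OF within_depth legal_atom, of \<mu>]
    by (auto simp: applicable_def open_branch_iff intro!: exI infer.extension)
qed

lemma applicable_iff:
  "applicable S d j T \<longleftrightarrow>
     legal S d j \<and> acts_at j \<in> nodes_of I - occupied I \<and> (\<exists>\<theta>. solves \<theta> I \<and> satisfies \<theta> I j)"
proof
  assume "applicable S d j T"
  then obtain T' where "infer S d j T T'" by (auto simp: applicable_def)
  from infer_perform[OF this] obtain \<mu> where "legal S d j" "open_branch T (acts_at j)"
      "most_general \<mu> (\<lambda>\<gamma>. satisfies (subst_comp \<gamma> (global_subst T)) I j)"
    by blast
  moreover have "solves (subst_comp \<mu> (global_subst T)) I"
    using most_general by (auto simp: most_general_def)
  ultimately show "legal S d j \<and> acts_at j \<in> nodes_of I - occupied I \<and>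
      (\<exists>\<theta>. solves \<theta> I \<and> satisfies \<theta> I j)"
    using most_general_self by (auto simp: open_branch_iff)
qed (blast intro: applicableI)

lemma label_perform:
  assumes "acts_at j \<notin> occupied I"
  shows "label (perform j T) q = Some L \<longleftrightarrow> lit_at (insert j I) q L"
proof (cases q rule: rev_cases)
  case Nil
  then show ?thesis by (cases j) (auto simp: label_attach close_leaf_def label lit_at_Nil)
next
  case (snoc p i)
  have "\<not> attached I (acts_at j) C" for C using assms attached_occupied by blast
  then show ?thesis
    using snoc
    by (cases j) (auto simp: label_attach close_leaf_def label lit_at_append attached_insert)
qed

lemma represents_infer:
  assumes "infer S d j T T'"
  shows "represents S d (insert j I) T'"
proof -
  obtain \<mu> where legal_j: "legal S d j" and open_j: "acts_at j \<in> nodes_of I - occupied I"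
    and unifier: "most_general \<mu> (\<lambda>\<gamma>. satisfies (subst_comp \<gamma> (global_subst T)) I j)"
    and result: "T' = extend_subst \<mu> (perform j T)"
    using infer_perform[OF assms] by (auto simp: open_branch_iff)
  interpret insert: well_formed S d "insert j I" using open_j legal_j by (rule well_formed_insert)
  show ?thesis
  proof
    show "label T' q = Some L \<longleftrightarrow> lit_at (insert j I) q L" for q L
      using label_perform open_j by (simp add: result extend_subst_def)
    show "expanded T' \<union> closed_leaves T' = occupied (insert j I)"
      using occupied_perform[of j T] occupied by (simp add: result extend_subst_def occupied_insert)
    show "most_general (global_subst T') (\<lambda>\<theta>. solves \<theta> (insert j I))"
      using most_general_comp[OF most_general unifier]
        solves_insert[OF well_formed_axioms open_j legal_j]
      by (simp add: result extend_subst_def global_subst_perform)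
  qed simp
qed

lemma infer_notin: "infer S d j T T' \<Longrightarrow> j \<notin> I"
  using infer_perform[of j T'] acts_at_occupied by (auto simp: open_branch_iff)

end

lemma represents_infers:
  assumes "represents S d I T" "infers S d js T T'"
  shows "represents S d (I \<union> set js) T'"
  using assms
proof (induction js arbitrary: I T)
  case (Cons j js)
  then obtain U where "infer S d j T U" "infers S d js U T'" by auto
  then show ?case
    using Cons.IH represents.represents_infer[OF Cons.prems(1)] by fastforce
qed simp

lemma represents_apply_all:
  assumes "represents S d I T" "apply_all S d E T T'"
  shows "represents S d (I \<union> E) T'"
  using assms represents_infers unfolding apply_all_def by blast

section \<open>Replaying inferences\<close>

locale solved = well_formed S d J
  for S :: "('f, 'p, 'v) clause set" and d :: nat and J :: "('f, 'p, 'v) atom set" +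
  fixes \<theta> :: "pos \<times> 'v \<Rightarrow> ('f, pos \<times> 'v) tm"
  assumes solves: "solves \<theta> J"

sublocale represents \<subseteq> solved S d I "global_subst T"
  by unfold_locales (rule solves_global_subst)

lemma solved_subset:
  assumes "solved S d J \<theta>" "I \<subseteq> J" "\<And>j. j \<in> I \<Longrightarrow> acts_at j \<in> nodes_of I"
  shows "solved S d I \<theta>"
proof -
  interpret J: solved S d J \<theta> by fact
  show ?thesis
    using well_formed_subset[OF J.well_formed_axioms assms(2,3)]
      solves_antimono[OF assms(2) J.solves]
    by (simp add: solved_def solved_axioms_def)
qed

lemma apply_all_empty: "apply_all S d {} T T"
  by (simp add: apply_all_def)

lemma apply_all_insert:
  assumes "infer S d j T U" "apply_all S d E U V" "j \<notin> E"
  shows "apply_all S d (insert j E) T V"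
proof -
  obtain js where "distinct js" "set js = E" "infers S d js U V"
    using assms(2) by (auto simp: apply_all_def)
  then have "distinct (j # js) \<and> set (j # js) = insert j E \<and> infers S d (j # js) T V"
    using assms(1,3) by auto
  then show ?thesis unfolding apply_all_def by blast
qed

context solved
begin

lemma applicable_subset:
  assumes "represents S d I T" "I \<subseteq> J" "j \<in> J - I" "acts_at j \<in> nodes_of I"
  shows "applicable S d j T"
proof -
  interpret I: represents S d I T by fact
  have "acts_at j \<notin> occupied I"
    using assms(2,3) acts_at_occupies occupied_unique by (fastforce simp: occupied_def)
  moreover have "solves \<theta> I" using assms(2) solves by (rule solves_antimono)
  moreover have "satisfies \<theta> I j"
  proof (rule satisfies_antimono[OF assms(2)])
    show "satisfies \<theta> J j" using assms(3) solves by (simp add: solves_def)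
  qed
  ultimately show ?thesis
    using I.applicableI assms(3,4) legal by blast
qed

lemma minimal_missing_node:
  assumes "I \<subset> J"
  obtains j where "j \<in> J - I" "acts_at j \<in> nodes_of I"
proof -
  obtain i where "i \<in> J - I" using assms by blast
  then obtain j where missing: "j \<in> J - I"
    and shortest: "\<And>k. k \<in> J - I \<Longrightarrow> length (acts_at j) \<le> length (acts_at k)"
    using ex_has_least_nat[of "\<lambda>j. j \<in> J - I" i "length \<circ> acts_at"] by auto
  have "acts_at j \<in> nodes_of I"
  proof (cases "acts_at j" rule: rev_cases)
    case (snoc p i)
    then obtain C where parent_clause: "attached J p C" "i < length C"
      using acts_at_node missing by (metis DiffD1 nodes_of_append)
    have parent_present: "k \<in> I" if "k \<in> J" "acts_at k = p" for k
      using that shortest[of k] snoc by auto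
    from parent_clause(1) have "attached I p C"
      by cases (fastforce dest: parent_present intro: attached.intros)+
    then show ?thesis using parent_clause(2) snoc by (auto simp: nodes_of_append)
  qed (simp add: nodes_of_Nil)
  with missing show ?thesis by (rule that)
qed

text \<open>Unifiability does not depend on the order of the connections, so any order of the inferences
  that respects the ancestor relation can be replayed.\<close>

lemma apply_all_exists:
  assumes "represents S d I T" "I \<subseteq> J"
  shows "\<exists>T'. apply_all S d (J - I) T T'"
  using assms
proof (induction "card (J - I)" arbitrary: I T rule: less_induct)
  case less
  show ?case
  proof (cases "I = J")
    case True
    then show ?thesis using apply_all_empty by auto
  next
    case False
    then obtain j where missing: "j \<in> J - I" "acts_at j \<in> nodes_of I"
      using less.prems(2) minimal_missing_node by blast
    then obtain U where first_step: "infer S d j T U"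
      using applicable_subset[OF less.prems] by (auto simp: applicable_def)
    have "card (J - insert j I) < card (J - I)"
      using finite_inferences missing by (intro psubset_card_mono) auto
    then obtain T' where "apply_all S d (J - insert j I) U T'"
      using less.hyps[of "insert j I" U] less.prems(2) missing
        represents.represents_infer[OF less.prems(1) first_step] by blast
    with first_step have "apply_all S d (insert j (J - insert j I)) T T'"
      by (rule apply_all_insert) simp
    moreover have "insert j (J - insert j I) = J - I" using missing(1) by blast
    ultimately show ?thesis by auto
  qed
qed

end

lemma path_inferences_subset: "path_inferences I p \<subseteq> I"
  by (auto simp: path_inferences_def)

lemma path_inferences_acts_at:
  assumes "j \<in> path_inferences I p"
  shows "strict_prefix (acts_at j) p"
  using assms by (auto simp: path_inferences_def strict_prefix_def)

lemma attached_path_inferences: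
  assumes "attached I q C" "strict_prefix q p"
  shows "attached (path_inferences I p) q C"
  using assms by (auto simp: attached.simps path_inferences_def)

lemma nodes_of_path_inferences:
  assumes "q \<in> nodes_of I" "prefix q p"
  shows "q \<in> nodes_of (path_inferences I p)"
proof (cases q rule: rev_cases)
  case (snoc r i)
  moreover have "strict_prefix r p"
    using assms(2) snoc by (auto simp: prefix_def strict_prefix_def)
  ultimately show ?thesis
    using assms(1) by (auto simp: nodes_of_append dest: attached_path_inferences)
qed (simp add: nodes_of_Nil)

lemma (in solved) solved_path_inferences: "solved S d (path_inferences J p) \<theta>"
proof (rule solved_subset[OF solved_axioms path_inferences_subset])
  fix j assume on_path: "j \<in> path_inferences J p"
  then have "acts_at j \<in> nodes_of J"
    using path_inferences_subset acts_at_node by blast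
  moreover have "prefix (acts_at j) p"
    using path_inferences_acts_at[OF on_path] by (simp add: strict_prefix_def)
  ultimately show "acts_at j \<in> nodes_of (path_inferences J p)" by (rule nodes_of_path_inferences)
qed

lemma (in solved) path_tableau_exists:
  obtains T where "apply_all S d (path_inferences J p) empty_tableau T"
    and "represents S d (path_inferences J p) T"
proof -
  interpret path: solved S d "path_inferences J p" \<theta> by (rule solved_path_inferences)
  obtain T where "apply_all S d (path_inferences J p) empty_tableau T"
    using path.apply_all_exists[OF represents_empty] by auto
  with represents_apply_all[OF represents_empty this] show ?thesis using that by simp
qed

lemma (in represents) failure_reason_exists:
  assumes "\<not> applicable S d j T"
  shows "\<exists>E. failure_reason S d I p j E"
proof -
  let ?path = "path_inferences I p"
  define preventing where "preventing = {E. E \<subseteq> I - ?path \<and> prevents S d I p j E}"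
  obtain T' where path_applied: "apply_all S d ?path empty_tableau T'"
    and path_tableau: "represents S d ?path T'"
    by (rule path_tableau_exists)
  obtain T'' where rest_applied: "apply_all S d (I - ?path) T' T''"
    using apply_all_exists[OF path_tableau path_inferences_subset] by blast
  have "?path \<union> (I - ?path) = I" using path_inferences_subset by blast
  then have "represents S d I T''"
    using represents_apply_all[OF path_tableau rest_applied] by simp
  then have "\<not> applicable S d j T''"
    using assms by (simp add: applicable_iff represents.applicable_iff)
  then have "prevents S d I p j (I - ?path)"
    using path_applied rest_applied unfolding prevents_def by blast
  then have "I - ?path \<in> preventing" by (simp add: preventing_def)
  moreover have "finite preventing" using finite_inferences by (simp add: preventing_def)
  ultimately obtain E where "E \<in> preventing" "\<forall>F \<in> preventing. F \<subseteq> E \<longrightarrow> E = F"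
    using finite_has_minimal2[of preventing "I - ?path"] by auto
  then have "failure_reason S d I p j E"
    by (auto simp: failure_reason_def preventing_def)
  then show ?thesis ..
qed

locale shared_branch = I: represents S d I T + J: solved S d J \<theta>
  for S :: "('f, 'p, 'v) clause set" and d I T J \<theta> +
  fixes p :: pos
  assumes open_branch: "open_branch T p"
    and path_subset: "path_inferences I p \<subseteq> J"
begin

lemma branch_node: "p \<in> nodes_of (path_inferences I p)"
  using open_branch by (intro nodes_of_path_inferences) (simp_all add: I.open_branch_iff)

lemma branch_unoccupied: "p \<notin> occupied I"
  using open_branch by (simp add: I.open_branch_iff)

lemma applicable_at_branch:
  assumes "represents S d K U" "path_inferences I p \<subseteq> K" "K \<subseteq> I" "K \<subseteq> J"
    and "j \<in> J" "acts_at j = p"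
  shows "applicable S d j U"
proof (rule J.applicable_subset[OF assms(1,4)])
  show "j \<in> J - K"
    using assms(3,5,6) branch_unoccupied acts_at_occupied by blast
  show "acts_at j \<in> nodes_of K"
    using branch_node nodes_of_mono[OF assms(2)] assms(6) by blast
qed

lemma possible_inference:
  assumes "j \<in> J" "acts_at j = p"
  shows "j \<in> possible_inferences S d I p"
proof -
  obtain U where path_applied: "apply_all S d (path_inferences I p) empty_tableau U"
    and path_tableau: "represents S d (path_inferences I p) U"
    by (rule I.path_tableau_exists)
  have "applicable S d j U"
    using path_tableau subset_refl path_inferences_subset path_subset assms
    by (rule applicable_at_branch)
  with path_applied show ?thesis using assms(2) by (auto simp: possible_inferences_def)
qed

lemma failure_reason_not_subset:
  assumes "j \<in> J" "acts_at j = p" and reason: "failure_reason S d I p j E"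
  shows "\<not> E \<subseteq> J"
proof
  assume "E \<subseteq> J"
  let ?path = "path_inferences I p"
  have "E \<subseteq> I" using reason by (auto simp: failure_reason_def)
  obtain U V where path_applied: "apply_all S d ?path empty_tableau U"
    and reason_applied: "apply_all S d E U V"
    and prevented: "\<not> applicable S d j V"
    using reason by (auto simp: failure_reason_def prevents_def)
  have "represents S d ?path U"
    using represents_apply_all[OF represents_empty path_applied] by simp
  then have "represents S d (?path \<union> E) V"
    using reason_applied by (rule represents_apply_all)
  then have "applicable S d j V"
    using \<open>E \<subseteq> I\<close> \<open>E \<subseteq> J\<close> path_subset assms(1,2)
    by (intro applicable_at_branch[OF _ Un_upper1] Un_least path_inferences_subset)
  with prevented show False by blast
qed

lemma acting_inference_exists:
  assumes "nodes_of J \<subseteq> occupied J"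
  obtains j where "j \<in> J" "acts_at j = p"
proof -
  have "p \<in> nodes_of J" using branch_node nodes_of_mono[OF path_subset] by blast
  then obtain j where occupant: "j \<in> J" "p \<in> occupies j" using assms by (auto simp: occupied_def)
  have "acts_at j = p"
  proof (rule ccontr)
    assume "acts_at j \<noteq> p"
    then obtain C q i where "j = Extension C q i" "p = q @ [i]" using occupant(2) by (cases j) auto
    then obtain D where "attached (path_inferences I p) q D"
      using branch_node by (metis nodes_of_append)
    then obtain k where parent: "k \<in> path_inferences I p" "acts_at k = q"
      by (rule attached_acts_at)
    then have "k = j"
      using J.acts_at_unique path_subset parent occupant(1) \<open>j = Extension C q i\<close> by auto
    then have "p \<in> occupied I"
      using parent(1) path_inferences_subset occupant(2) by (auto simp: occupied_def)
    then show False using branch_unoccupied by blast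
  qed
  with occupant(1) show ?thesis by (rule that)
qed

end

section \<open>The search\<close>

definition literal_indices :: "('f, 'p, 'v) clause set \<Rightarrow> nat set" where
  "literal_indices S = (\<Union>C \<in> S. {..<length C})"

definition bounded_positions :: "('f, 'p, 'v) clause set \<Rightarrow> nat \<Rightarrow> pos set" where
  "bounded_positions S d = {p. set p \<subseteq> literal_indices S \<and> length p \<le> d}"

definition atom_space :: "('f, 'p, 'v) clause set \<Rightarrow> nat \<Rightarrow> ('f, 'p, 'v) atom set" where
  "atom_space S d = Start ` S \<union>
     (\<lambda>(q, p). Reduction q p) ` (bounded_positions S d \<times> bounded_positions S d) \<union>
     (\<lambda>(C, p, i). Extension C p i) ` (S \<times> bounded_positions S d \<times> literal_indices S)"

lemma finite_atom_space:
  assumes "finite S"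
  shows "finite (atom_space S d)"
proof -
  have "finite (literal_indices S)" using assms by (simp add: literal_indices_def)
  moreover from this have "finite (bounded_positions S d)"
    unfolding bounded_positions_def by (rule finite_lists_length_le)
  ultimately show ?thesis using assms by (simp add: atom_space_def)
qed

context well_formed
begin

lemma set_node_subset: "p \<in> nodes_of I \<Longrightarrow> set p \<subseteq> literal_indices S"
proof (induction p rule: rev_induct)
  case (snoc i p)
  then obtain C where parent: "attached I p C" "i < length C" by (auto simp: nodes_of_append)
  then have "i \<in> literal_indices S" using attached_legal(1) by (auto simp: literal_indices_def)
  moreover have "set p \<subseteq> literal_indices S" using snoc.IH attached_legal(3)[OF parent(1)] by blast
  ultimately show ?case by simp
qed simp

lemma subset_atom_space: "I \<subseteq> atom_space S d"
proof
  fix j assume member: "j \<in> I"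
  have bounded: "q \<in> bounded_positions S d" if "prefix q (acts_at j)" for q
    using prefix_node[OF acts_at_node[OF member] that] length_node_le set_node_subset
    by (simp add: bounded_positions_def)
  show "j \<in> atom_space S d"
    using legal[OF member] bounded
    by (cases j) (auto simp: atom_space_def literal_indices_def image_iff strict_prefix_def)
qed

end

lemma possible_inferences_atom_space: "possible_inferences S d I p \<subseteq> atom_space S d"
proof
  fix j assume "j \<in> possible_inferences S d I p"
  then obtain T T' where path_applied: "apply_all S d (path_inferences I p) empty_tableau T"
    and step: "infer S d j T T'"
    by (auto simp: possible_inferences_def applicable_def)
  interpret path: represents S d "path_inferences I p" T
    using represents_apply_all[OF represents_empty path_applied] by simp
  interpret represents S d "insert j (path_inferences I p)" T'
    using step by (rule path.represents_infer)
  show "j \<in> atom_space S d" using subset_atom_space by blast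
qed

fun derived_trail ::
  "('f, 'p, 'v) clause set \<Rightarrow> nat \<Rightarrow> ('f, 'p, 'v) tableau \<Rightarrow> ('f, 'p, 'v) trail \<Rightarrow> bool" where
  "derived_trail S d T [] \<longleftrightarrow> T = empty_tableau"
| "derived_trail S d T ((j, U) # tr) \<longleftrightarrow> infer S d j U T \<and> derived_trail S d U tr"

lemma trail_atoms_Nil: "trail_atoms [] = {}"
  by (simp add: trail_atoms_def)

lemma trail_atoms_Cons: "trail_atoms ((j, T) # tr) = insert j (trail_atoms tr)"
  by (simp add: trail_atoms_def)

lemma derived_trail_represents:
  "derived_trail S d T tr \<Longrightarrow> represents S d (trail_atoms tr) T"
  by (induction S d T tr rule: derived_trail.induct)
    (auto simp: trail_atoms_Nil trail_atoms_Cons represents_empty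
      intro: represents.represents_infer)

lemma infers_append: "infers S d (xs @ ys) T V \<longleftrightarrow> (\<exists>U. infers S d xs T U \<and> infers S d ys U V)"
  by (induction xs arbitrary: T) auto

lemma derived_trail_infers:
  "derived_trail S d T tr \<Longrightarrow> infers S d (rev (map fst tr)) empty_tableau T"
  by (induction S d T tr rule: derived_trail.induct) (auto simp: infers_append)

lemma length_derived_trail:
  "derived_trail S d T tr \<Longrightarrow> length tr = card (trail_atoms tr)"
proof (induction S d T tr rule: derived_trail.induct[case_names Nil Cons])
  case (Cons S d T j U tr)
  then have "represents S d (trail_atoms tr) U" by (auto intro: derived_trail_represents)
  then have "j \<notin> trail_atoms tr" using Cons represents.infer_notin by force
  moreover have "finite (trail_atoms tr)" by (simp add: trail_atoms_def)
  ultimately show ?case using Cons by (simp add: trail_atoms_Cons)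
qed (simp add: trail_atoms_Nil)

lemma length_derived_trail_le:
  assumes "finite S" "derived_trail S d T tr"
  shows "length tr \<le> card (atom_space S d)"
proof -
  interpret represents S d "trail_atoms tr" T using assms(2) by (rule derived_trail_represents)
  show ?thesis
    unfolding length_derived_trail[OF assms(2)]
    using finite_atom_space[OF assms(1)] subset_atom_space by (rule card_mono)
qed

lemma try_each_Stuck_mono: "try_each S d s p js c (Stuck c') \<Longrightarrow> c \<subseteq> c'"
  by (induction js c "Stuck c' :: ('a, 'b, 'c) outcome" rule: try_each.induct) auto

lemma try_each_Stuck_subset_trail:
  assumes "try_each S d s p js c (Stuck c')" "c \<subseteq> trail_atoms (trail s)"
  shows "c' \<subseteq> trail_atoms (trail s)"
  using assms
  by (induction js c "Stuck c'" rule: try_each.induct)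
    (auto simp: failure_reason_def blocks_def violated_def)

lemma try_each_Stuck_cases:
  assumes "try_each S d s p js c (Stuck c')" "j \<in> set js"
  obtains (failure) E where "failure_reason S d (trail_atoms (trail s)) p j E" "E \<subseteq> c'"
  | (blocked) b where "b \<in> learned s" "b - {j} \<subseteq> c'"
  using assms
proof (induction js c "Stuck c'" arbitrary: thesis rule: try_each.induct)
  case (fails k E js c)
  then show ?case using try_each_Stuck_mono[OF fails.hyps(3)] by auto
next
  case (blocked k b c js)
  then show ?case using try_each_Stuck_mono[OF blocked.hyps(4)] by auto
qed simp

lemma try_each_Applied:
  assumes "try_each S d s p js c (Applied j T)"
  shows "infer S d j (current s) T" and "b \<in> learned s \<Longrightarrow> \<not> blocks (trail_atoms (trail s)) j b"
  using assms by (induction js c "Applied j T" rule: try_each.induct) auto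

lemma try_each_exists:
  assumes "\<And>j. \<not> applicable S d j (current s) \<Longrightarrow>
    \<exists>E. failure_reason S d (trail_atoms (trail s)) p j E"
  shows "\<exists>r. try_each S d s p js c r"
proof (induction js arbitrary: c)
  case Nil
  show ?case using try_each.exhausted by blast
next
  case (Cons j js)
  consider (prevented) "\<not> applicable S d j (current s)"
    | (blocked) b where "applicable S d j (current s)" "b \<in> learned s"
        "blocks (trail_atoms (trail s)) j b"
    | (applied) T where "infer S d j (current s) T"
        "\<forall>b \<in> learned s. \<not> blocks (trail_atoms (trail s)) j b"
    by (auto simp: applicable_def)
  then show ?case
  proof cases
    case prevented
    then show ?thesis using assms Cons try_each.fails by meson
  next
    case blocked
    then show ?thesis using Cons try_each.blocked by meson
  next
    case applied
    then show ?thesis using try_each.succeeds by meson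
  qed
qed

lemma derived_trail_backtrack:
  assumes "backtrack c T tr = (T', tr')" "derived_trail S d T tr"
  shows "derived_trail S d T' tr'"
  using assms by (induction c T tr rule: backtrack.induct) (auto split: if_splits)

lemma backtrack_subset: "backtrack c T tr = (T', tr') \<Longrightarrow> trail_atoms tr' \<subseteq> trail_atoms tr"
  by (induction c T tr rule: backtrack.induct) (auto simp: trail_atoms_Cons split: if_splits)

lemma backtrack_not_violated:
  assumes "backtrack c T tr = (T', tr')" "c \<noteq> {}"
  shows "\<not> violated c (trail_atoms tr')"
  using assms by (induction c T tr rule: backtrack.induct)
    (auto simp: trail_atoms_Nil violated_def split: if_splits)

text \<open>The empty constraint is exempt: every trail violates it, and learning it ends the search.\<close>

definition search_invariant ::
  "('f, 'p, 'v) clause set \<Rightarrow> nat \<Rightarrow> ('f, 'p, 'v) state \<Rightarrow> bool" where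
  "search_invariant S d s \<longleftrightarrow> derived_trail S d (current s) (trail s) \<and>
     (\<forall>c \<in> learned s. c \<subseteq> atom_space S d \<and> (c = {} \<or> \<not> violated c (trail_atoms (trail s))))"

definition search_order ::
  "('f, 'p, 'v) clause set \<Rightarrow> nat \<Rightarrow> (('f, 'p, 'v) state \<times> ('f, 'p, 'v) state) set" where
  "search_order S d = measures
     [\<lambda>s. card (Pow (atom_space S d) - learned s), \<lambda>s. card (atom_space S d) - length (trail s)]"

lemma search_invariant_initial: "search_invariant S d initial_state"
  by (simp add: search_invariant_def initial_state_def)

lemma search_invariant_represents:
  "search_invariant S d s \<Longrightarrow> represents S d (trail_atoms (trail s)) (current s)"
  by (simp add: search_invariant_def derived_trail_represents)

lemma stuck_subset_trail:
  assumes "try_each S d s p js (path_inferences (trail_atoms (trail s)) p) (Stuck c)"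
  shows "c \<subseteq> trail_atoms (trail s)"
  using assms path_inferences_subset by (rule try_each_Stuck_subset_trail)

lemma search_invariant_iteration:
  assumes invariant: "search_invariant S d s" and step: "iteration S d s s'"
  shows "search_invariant S d s'"
proof -
  interpret represents S d "trail_atoms (trail s)" "current s"
    using invariant by (rule search_invariant_represents)
  have derived: "derived_trail S d (current s) (trail s)"
    and space: "\<And>c. c \<in> learned s \<Longrightarrow> c \<subseteq> atom_space S d"
    and avoided: "\<And>c. c \<in> learned s \<Longrightarrow> c = {} \<or> \<not> violated c (trail_atoms (trail s))"
    using invariant by (auto simp: search_invariant_def)
  show ?thesis
    using step
  proof cases
    case (apply_inference p I js j T')
    note applied =
      try_each_Applied[OF \<open>try_each S d s p js (path_inferences I p) (Applied j T')\<close>]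
    have "c = {} \<or> \<not> violated c (insert j (trail_atoms (trail s)))" if "c \<in> learned s" for c
      using applied(2)[OF that] avoided[OF that] by (auto simp: blocks_def violated_def)
    then show ?thesis
      using apply_inference(1) applied(1) derived space
      by (simp add: search_invariant_def trail_atoms_Cons)
  next
    case (learn_constraint p I js c T' tr')
    note backtrack = \<open>backtrack c (current s) (trail s) = (T', tr')\<close>
    have "c \<subseteq> atom_space S d"
      using stuck_subset_trail learn_constraint subset_atom_space by blast
    moreover have "b = {} \<or> \<not> violated b (trail_atoms tr')" if "b \<in> insert c (learned s)" for b
      using that avoided backtrack_subset[OF backtrack] backtrack_not_violated[OF backtrack]
      by (auto simp: violated_def)
    ultimately show ?thesis
      using learn_constraint(1) derived_trail_backtrack[OF backtrack derived] space
      by (simp add: search_invariant_def)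
  qed
qed

text \<open>Each learned constraint is violated by the trail on which it was learned, whereas the earlier
  ones are not; so it is new.\<close>

lemma iteration_decreases:
  assumes "finite S" and invariant: "search_invariant S d s" and step: "iteration S d s s'"
  shows "(s', s) \<in> search_order S d"
  using step
proof cases
  case (apply_inference p I js j T')
  have "derived_trail S d (current s') (trail s')"
    using search_invariant_iteration[OF invariant step] by (simp add: search_invariant_def)
  then have "length (trail s') \<le> card (atom_space S d)"
    by (rule length_derived_trail_le[OF assms(1)])
  then show ?thesis using apply_inference(1) by (simp add: search_order_def)
next
  case (learn_constraint p I js c T' tr')
  have "c \<subseteq> trail_atoms (trail s)"
    using stuck_subset_trail learn_constraint by blast
  then have "c \<notin> learned s"
    using invariant \<open>\<not> stopped s\<close> by (auto simp: search_invariant_def stopped_def violated_def)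
  moreover have "c \<in> learned s'" "learned s \<subseteq> learned s'" using learn_constraint(1) by auto
  moreover have "c \<subseteq> atom_space S d"
    using search_invariant_iteration[OF invariant step] \<open>c \<in> learned s'\<close>
    by (simp add: search_invariant_def)
  ultimately have "Pow (atom_space S d) - learned s' \<subset> Pow (atom_space S d) - learned s" by blast
  then show ?thesis
    unfolding search_order_def
    by (intro measures_less psubset_card_mono) (simp add: finite_atom_space assms(1))
qed

lemma search_invariant_reachable:
  "(iteration S d)\<^sup>*\<^sup>* initial_state s \<Longrightarrow> search_invariant S d s"
  by (induction rule: rtranclp_induct)
    (auto intro: search_invariant_initial search_invariant_iteration)

lemma search_terminates:
  assumes "finite S"
  shows "\<nexists>run. run 0 = initial_state \<and> (\<forall>n. iteration S d (run n) (run (Suc n)))"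
proof
  assume "\<exists>run. run 0 = initial_state \<and> (\<forall>n. iteration S d (run n) (run (Suc n)))"
  then obtain run where start: "run 0 = initial_state"
    and steps: "\<And>n. iteration S d (run n) (run (Suc n))" by blast
  have "search_invariant S d (run n)" for n
    using search_invariant_iteration[OF _ steps]
    by (induction n) (simp_all add: start search_invariant_initial)
  then have "\<forall>n. (run (Suc n), run n) \<in> search_order S d"
    using iteration_decreases[OF assms _ steps] by blast
  moreover have "wf (search_order S d)" by (simp add: search_order_def)
  ultimately show False unfolding wf_iff_no_infinite_down_chain by blast
qed

lemma iteration_exists:
  assumes "finite S" "search_invariant S d s" "\<not> stopped s"
  shows "\<exists>s'. iteration S d s s'"
proof -
  let ?I = "trail_atoms (trail s)"
  interpret represents S d ?I "current s"
    using assms(2) by (rule search_invariant_represents)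
  obtain p where selected: "open_branch (current s) p"
    using assms(3) by (auto simp: stopped_def is_closed_def)
  have "finite (possible_inferences S d ?I p)"
    using possible_inferences_atom_space finite_atom_space[OF assms(1)] by (rule finite_subset)
  then obtain js where order: "distinct js" "set js = possible_inferences S d ?I p"
    using finite_distinct_list by metis
  obtain r where tried: "try_each S d s p js (path_inferences ?I p) r"
    using try_each_exists failure_reason_exists by metis
  show ?thesis
  proof (cases r)
    case (Applied j T')
    with tried show ?thesis
      using iteration.apply_inference[OF assms(3) selected refl order] by blast
  next
    case (Stuck c)
    obtain T' tr' where "backtrack c (current s) (trail s) = (T', tr')" by (rule prod.exhaust)
    with tried Stuck show ?thesis
      using iteration.learn_constraint[OF assms(3) selected refl order] by blast
  qed
qed

lemma stuck_not_violated:
  assumes derived: "represents S d (trail_atoms (trail s)) (current s)"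
    and selected: "open_branch (current s) p"
    and order: "set js = possible_inferences S d (trail_atoms (trail s)) p"
    and stuck: "try_each S d s p js (path_inferences (trail_atoms (trail s)) p) (Stuck c)"
    and solved: "solved S d J \<theta>" and closed: "nodes_of J \<subseteq> occupied J"
    and avoided: "\<forall>b \<in> learned s. \<not> violated b J"
  shows "\<not> violated c J"
proof
  assume "violated c J"
  then have subset: "c \<subseteq> J" by (simp add: violated_def)
  then interpret shared_branch S d "trail_atoms (trail s)" "current s" J \<theta> p
    using derived solved selected try_each_Stuck_mono[OF stuck]
    by (auto simp: shared_branch_def shared_branch_axioms_def)
  obtain j where acting: "j \<in> J" "acts_at j = p"
    using closed by (rule acting_inference_exists)
  then have "j \<in> set js" unfolding order by (rule possible_inference)
  with stuck show False
  proof (cases rule: try_each_Stuck_cases)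
    case (failure E)
    then show False using failure_reason_not_subset[OF acting] subset by blast
  next
    case (blocked b)
    then have "violated b J" using subset acting(1) by (auto simp: violated_def)
    then show False using avoided blocked(1) by blast
  qed
qed

lemma learned_not_violated:
  assumes closed: "solved S d J \<theta>" "nodes_of J \<subseteq> occupied J"
    and reachable: "(iteration S d)\<^sup>*\<^sup>* initial_state s"
  shows "\<forall>c \<in> learned s. \<not> violated c J"
  using reachable
proof (induction rule: rtranclp_induct)
  case base
  show ?case by (simp add: initial_state_def)
next
  case (step s s')
  have derived: "represents S d (trail_atoms (trail s)) (current s)"
    using step.hyps(1) by (intro search_invariant_represents search_invariant_reachable)
  from step.hyps(2) show ?case
  proof cases
    case apply_inference
    then show ?thesis using step.IH by simp
  next
    case (learn_constraint p I js c)
    then show ?thesis using stuck_not_violated[OF derived _ _ _ closed step.IH] step.IH by simp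
  qed
qed

lemma closed_tableau_solved:
  assumes "closed_tableau S d T"
  obtains J \<theta> where "solved S d J \<theta>" "nodes_of J \<subseteq> occupied J"
proof -
  obtain js where derivation: "infers S d js empty_tableau T" and closed: "is_closed T"
    using assms by (auto simp: closed_tableau_def)
  interpret represents S d "set js" T
    using represents_infers[OF represents_empty derivation] by simp
  have "nodes_of (set js) \<subseteq> occupied (set js)"
    using closed by (auto simp: is_closed_def open_branch_iff)
  then show ?thesis using that solved_axioms by blast
qed

theorem theorem1:
  fixes S :: "('f, 'p, 'v) clause set" and d :: nat
  assumes "finite S"
    and "\<exists>T. closed_tableau S d T"
  shows "(\<nexists>run. run 0 = (initial_state :: ('f, 'p, 'v) state) \<and>
                (\<forall>n. iteration S d (run n) (run (Suc n)))) \<and>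
         (\<forall>s. (iteration S d)\<^sup>*\<^sup>* initial_state s \<and> (\<nexists>s'. iteration S d s s') \<longrightarrow>
              closed_tableau S d (current s) \<and> {} \<notin> learned s)"
proof (intro conjI[OF search_terminates[OF assms(1)]] allI impI)
  fix s :: "('f, 'p, 'v) state"
  assume final: "(iteration S d)\<^sup>*\<^sup>* initial_state s \<and> (\<nexists>s'. iteration S d s s')"
  then have invariant: "search_invariant S d s"
    by (blast intro: search_invariant_reachable)
  obtain J \<theta> where "solved S d J \<theta>" "nodes_of J \<subseteq> occupied J"
    using assms(2) closed_tableau_solved by blast
  then have "\<forall>c \<in> learned s. \<not> violated c J" by (rule learned_not_violated) (use final in blast)
  then have not_learned: "{} \<notin> learned s" by (auto simp: violated_def)
  have "stopped s" using iteration_exists[OF assms(1) invariant] final by blast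
  then have "is_closed (current s)" using not_learned by (simp add: stopped_def)
  moreover have "infers S d (rev (map fst (trail s))) empty_tableau (current s)"
    using invariant by (simp add: search_invariant_def derived_trail_infers)
  ultimately show "closed_tableau S d (current s) \<and> {} \<notin> learned s"
    using not_learned unfolding closed_tableau_def by blast
qed

end
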